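(* Let $K_3$ be the associative unital algebra (over the ground field) with generators $u(1),u(2),u(3),u(12),u(13),u(23)$ and the following five relations (with $[x,y]=xy-yx$): $$[u(1),u(2)]+u(12)(u(2)-u(1))=0,$$ $$[u(2),u(3)]+u(23)(u(3)-u(2))=0,$$ $$[u(3),u(1)]+u(13)(u(1)-u(3))=0,$$ $$[u(12),u(23)]+[u(12),u(3)]+[u(1),u(23)]-u(13)(u(12)-u(23))=0,$$ $$[u(12),u(13)]+[u(12),u(3)]+[u(2),u(13)]-u(23)(u(12)-u(13))=0.$$ Then the Hilbert series of $K_3$ is $$H(x)=\frac{1}{x^3-6x^2+5x-1}.$$
   Context: The ground field is not specified. The algebra $K_3$ is graded with every generator in degree $1$ (all relations are homogeneous of degree $2$). Its Hilbert series is the generating function $H(x)=\sum_{n\ge 0}\dim (K_3)_n\,x^n$, where $(K_3)_n$ is the degree-$n$ component.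
   Formalization: The printed series 1/(x^3-6x^2+5x-1) has constant term -1, which is not a dimension; the theorem proved is H(x)=1/(1-6x+5x^2-x^3), with the coefficients of the denominator in reverse order, over every ground field. *)

theory Defs
  imports
    "HOL-Library.Poly_Mapping"
    "HOL-Computational_Algebra.Formal_Power_Series"
begin

text \<open>
  The free monoid on \<open>'a\<close>, written additively because \<^theory>\<open>HOL-Library.Poly_Mapping\<close>
  provides the convolution product for additively written (not necessarily commutative)
  exponent monoids.
\<close>

datatype 'a free_monoid = Word (letters: "'a list")

instantiation free_monoid :: (type) monoid_add
begin

definition zero_free_monoid :: "'a free_monoid"
  where "0 = Word []"

definition plus_free_monoid :: "'a free_monoid \<Rightarrow> 'a free_monoid \<Rightarrow> 'a free_monoid"
  where "v + w = Word (letters v @ letters w)"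

instance
  by standard (simp_all add: zero_free_monoid_def plus_free_monoid_def)

end

text \<open>
  The free associative unital \<open>'k\<close>-algebra on \<open>'x\<close> is the monoid algebra of the free
  monoid: finitely supported functions on words, multiplied by convolution.
\<close>

type_synonym ('x, 'k) free_algebra = "'x free_monoid \<Rightarrow>\<^sub>0 'k"

definition gen :: "'x \<Rightarrow> ('x, 'k::field) free_algebra"
  where "gen x = Poly_Mapping.single (Word [x]) 1"

definition const :: "'k \<Rightarrow> ('x, 'k::field) free_algebra"
  where "const c = Poly_Mapping.single 0 c"

definition homogeneous :: "nat \<Rightarrow> ('x, 'k::field) free_algebra set"
  where "homogeneous n = {p. \<forall>w \<in> Poly_Mapping.keys p. length (letters w) = n}"

definition two_sided_ideal :: "'a::ring_1 set \<Rightarrow> bool"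
  where "two_sided_ideal I \<longleftrightarrow>
    0 \<in> I \<and> (\<forall>x\<in>I. \<forall>y\<in>I. x + y \<in> I) \<and> (\<forall>x\<in>I. \<forall>a. a * x \<in> I \<and> x * a \<in> I)"

definition commutator :: "'a::ring_1 \<Rightarrow> 'a \<Rightarrow> 'a"
  where "commutator x y = x * y - y * x"

datatype index = I1 | I2 | I3 | I12 | I13 | I23

abbreviation u :: "index \<Rightarrow> (index, 'k::field) free_algebra"
  where "u \<equiv> gen"

definition K3_relators :: "(index, 'k::field) free_algebra set"
  where "K3_relators =
   {commutator (u I1) (u I2) + u I12 * (u I2 - u I1),
    commutator (u I2) (u I3) + u I23 * (u I3 - u I2),
    commutator (u I3) (u I1) + u I13 * (u I1 - u I3),
    commutator (u I12) (u I23) + commutator (u I12) (u I3) + commutator (u I1) (u I23)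
      - u I13 * (u I12 - u I23),
    commutator (u I12) (u I13) + commutator (u I12) (u I3) + commutator (u I2) (u I13)
      - u I23 * (u I12 - u I13)}"

definition K3_ideal :: "(index, 'k::field) free_algebra set"
  where "K3_ideal = two_sided_ideal hull K3_relators"

lemma two_sided_ideal_K3_ideal: "two_sided_ideal K3_ideal"
  unfolding K3_ideal_def by (rule hull_in) (auto simp: two_sided_ideal_def)

lemma K3_ideal_zero: "0 \<in> K3_ideal"
  and K3_ideal_add: "x \<in> K3_ideal \<Longrightarrow> y \<in> K3_ideal \<Longrightarrow> x + y \<in> K3_ideal"
  and K3_ideal_mult_left: "x \<in> K3_ideal \<Longrightarrow> a * x \<in> K3_ideal"
  and K3_ideal_mult_right: "x \<in> K3_ideal \<Longrightarrow> x * a \<in> K3_ideal"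
  using two_sided_ideal_K3_ideal by (auto simp: two_sided_ideal_def)

lemma K3_ideal_uminus: "x \<in> K3_ideal \<Longrightarrow> - x \<in> K3_ideal"
  using K3_ideal_mult_left[of x "- 1"] by simp

lemma K3_ideal_mult_diff:
  assumes "a - a' \<in> K3_ideal" "b - b' \<in> K3_ideal"
  shows "a * b - a' * b' \<in> K3_ideal"
proof -
  have "a * b - a' * b' = (a - a') * b + a' * (b - b')"
    by (simp add: algebra_simps)
  then show ?thesis
    using assms by (simp add: K3_ideal_add K3_ideal_mult_left K3_ideal_mult_right)
qed

definition K3_rel :: "(index, 'k::field) free_algebra \<Rightarrow> (index, 'k) free_algebra \<Rightarrow> bool"
  where "K3_rel x y \<longleftrightarrow> x - y \<in> K3_ideal"

lemma equivp_K3_rel: "equivp K3_rel"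
proof (rule equivpI)
  show "reflp K3_rel"
    by (simp add: reflp_def K3_rel_def K3_ideal_zero)
  show "symp K3_rel"
    unfolding symp_def K3_rel_def using K3_ideal_uminus by fastforce
  show "transp K3_rel"
    unfolding transp_def K3_rel_def using K3_ideal_add by fastforce
qed

quotient_type (overloaded) 'k K3 = "(index, 'k::field) free_algebra" / K3_rel
  by (rule equivp_K3_rel)

instantiation K3 :: (field) ring
begin

lift_definition zero_K3 :: "'k::field K3" is 0 .

lift_definition plus_K3 :: "'k::field K3 \<Rightarrow> 'k K3 \<Rightarrow> 'k K3" is "(+)"
  unfolding K3_rel_def using K3_ideal_add by (fastforce simp: algebra_simps)

lift_definition uminus_K3 :: "'k::field K3 \<Rightarrow> 'k K3" is uminus
  unfolding K3_rel_def using K3_ideal_uminus by fastforce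

lift_definition minus_K3 :: "'k::field K3 \<Rightarrow> 'k K3 \<Rightarrow> 'k K3" is "(-)"
  subgoal for a a' b b'
    unfolding K3_rel_def
    using K3_ideal_add[of "a - a'" "- (b - b')"] K3_ideal_uminus[of "b - b'"]
    by (simp add: algebra_simps)
  done

lift_definition times_K3 :: "'k::field K3 \<Rightarrow> 'k K3 \<Rightarrow> 'k K3" is "(*)"
  unfolding K3_rel_def by (rule K3_ideal_mult_diff)

instance
  by standard (transfer; simp add: K3_rel_def K3_ideal_zero algebra_simps)+

end

text \<open>
  Only \<open>ring\<close> and a constant \<open>1\<close>: the class \<open>ring_1\<close> also demands \<open>0 \<noteq> 1\<close>.
\<close>

instantiation K3 :: (field) monoid_mult
begin

lift_definition one_K3 :: "'k::field K3" is 1 .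

instance
  by standard (transfer; simp add: K3_rel_def K3_ideal_zero mult.assoc)+

end

lift_definition scale_K3 :: "'k::field \<Rightarrow> 'k K3 \<Rightarrow> 'k K3" is "\<lambda>c x. const c * x"
  unfolding K3_rel_def by (metis K3_ideal_mult_left right_diff_distrib)

interpretation K3: vector_space scale_K3
proof
  fix a b :: "'k::field" and x y :: "'k K3"
  show "scale_K3 a (x + y) = scale_K3 a x + scale_K3 a y"
    by transfer (simp add: K3_rel_def K3_ideal_zero algebra_simps)
  show "scale_K3 (a + b) x = scale_K3 a x + scale_K3 b x"
    by transfer (simp add: K3_rel_def K3_ideal_zero const_def single_add algebra_simps)
  show "scale_K3 a (scale_K3 b x) = scale_K3 (a * b) x"
    by transfer (simp add: K3_rel_def K3_ideal_zero const_def mult_single flip: mult.assoc)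
  show "scale_K3 1 x = x"
    by transfer (simp add: K3_rel_def K3_ideal_zero const_def)
qed

text \<open>
  The relators are homogeneous, so the grading of the free algebra (all generators in
  degree 1) descends, and the degree-\<open>n\<close> component is the image of the homogeneous
  elements of degree \<open>n\<close>.
\<close>

definition K3_component :: "nat \<Rightarrow> 'k::field K3 set"
  where "K3_component n = abs_K3 ` homogeneous n"

text \<open>
  The series begins \<open>1 + 6 x + 31 x\<^sup>2 + \<dots>\<close> (one unit, six generators, five independent
  quadratic relations among the 36 words of length 2), so it equals
  \<open>1 / (1 - 6 x + 5 x\<^sup>2 - x\<^sup>3)\<close>. The source prints the denominator with its coefficients in
  the opposite order, as \<open>x\<^sup>3 - 6 x\<^sup>2 + 5 x - 1\<close>, whose reciprocal has constant term \<open>- 1\<close>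
  and so cannot be a Hilbert series.
\<close>

definition K3_hilbert_series :: "'k::field itself \<Rightarrow> rat fps"
  where "K3_hilbert_series _ = Abs_fps (\<lambda>n. of_nat (K3.dim (K3_component n :: 'k K3 set)))"

end

theory Submission
  imports Defs
begin

text \<open>
  The relations of \<open>K\<^sub>3\<close> can be solved for products of two letters so that the resulting
  rewriting rules form a quadratic Groebner basis. Subtracting the fifth relation from the
  fourth and rearranging the others gives
  \<open>u(23)u(3) = u(3)u(2) + u(23)u(2) - u(2)u(3)\<close>,
  \<open>u(12)u(3) = u(3)u(12) + u(13)u(12) + u(23)u(12) - u(2)u(13) - u(12)u(13) + u(13)u(2) - u(23)u(13)\<close>,
  \<open>u(1)u(2) = u(2)u(1) + u(12)u(1) - u(12)u(2)\<close>,
  \<open>u(1)u(3) = u(3)u(1) + u(13)u(1) - u(13)u(3)\<close>,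
  \<open>u(1)u(23) = u(23)u(1) + u(2)u(13) - u(13)u(2) + u(12)u(13) - u(12)u(23) + u(23)u(13) - u(13)u(23)\<close>.
  Call a word normal if it contains none of the five left-hand sides. The only word of length
  three in which two left-hand sides overlap is \<open>u(1)u(23)u(3)\<close>, and its two reductions agree.
  Hence the normal words of length \<open>n\<close> form a basis of the component of degree \<open>n\<close>, over every
  field, because all coefficients are \<open>1\<close> or \<open>-1\<close>. Five left-hand sides with a single overlap
  give the recurrence \<open>t (n + 3) = 6 t (n + 2) - 5 t (n + 1) + t n\<close> for the number \<open>t n\<close> of normal
  words of length \<open>n\<close>, and its coefficients are those of the denominator of the series.

  Confluence enters through a representation. Left multiplication by a generator,
  followed by rewriting, is an operator that can be defined by recursion on words: no
  left-hand side begins with \<open>u(2)\<close>, \<open>u(3)\<close> or \<open>u(13)\<close>, so these three act by plain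
  multiplication; the rule for \<open>u(23)\<close> needs only them, the rule for \<open>u(12)\<close> needs in addition
  \<open>u(23)\<close>, and the rules for \<open>u(1)\<close> need in addition \<open>u(12)\<close> and \<open>u(23)\<close>. The operators satisfy the
  relations of \<open>K\<^sub>3\<close> on the whole free algebra, not only on the span of the normal words. All but
  one relation hold by construction, and the proof of the remaining one, \<open>act_u1_act_u23\<close>, is the
  overlap computation. Applying the operators to \<open>1\<close> gives a linear map \<open>normal_form\<close> that vanishes on the
  ideal, fixes normal words, sends words to combinations of normal words and does not change
  the class in \<open>K\<^sub>3\<close>; these four facts say that normal words are a basis.
\<close>

section \<open>The free algebra as a vector space\<close>

abbreviation scale_free :: "'k \<Rightarrow> ('x, 'k::field) free_algebra \<Rightarrow> ('x, 'k) free_algebra"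
  where "scale_free c p \<equiv> const c * p"

abbreviation word :: "'x list \<Rightarrow> ('x, 'k::field) free_algebra"
  where "word w \<equiv> Poly_Mapping.single (Word w) 1"

lemma gen_times_word: "gen x * word w = word (x # w)"
  by (simp add: gen_def mult_single plus_free_monoid_def)

lemma word_Nil: "word [] = 1"
  by (metis single_one zero_free_monoid_def)

lemma const_times_single: "const c * Poly_Mapping.single w d = Poly_Mapping.single w (c * d)"
  by (simp add: const_def mult_single)

lemma const_times_const: "const c * const d = const (c * d)"
  by (simp add: const_def mult_single)

lemma free_algebra_expansion:
  "p = (\<Sum>w\<in>Poly_Mapping.keys p. const (Poly_Mapping.lookup p w) * word (letters w))"
proof (rule poly_mapping_eqI)
  fix k
  show "Poly_Mapping.lookup p k = Poly_Mapping.lookup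
    (\<Sum>w\<in>Poly_Mapping.keys p. const (Poly_Mapping.lookup p w) * word (letters w)) k"
    by (auto simp: lookup_sum const_times_single lookup_single when_def in_keys_iff)
qed

lemma lookup_const_times: "Poly_Mapping.lookup (const c * p) w = c * Poly_Mapping.lookup p w"
  by (subst (1 2) free_algebra_expansion[of p])
    (simp add: sum_distrib_left lookup_sum const_times_single flip: mult.assoc,
     simp add: lookup_single when_def const_def mult_single sum_distrib_left mult.assoc if_distrib cong: if_cong)

lemma vector_space_free: "vector_space (scale_free :: 'k::field \<Rightarrow> ('x, 'k) free_algebra \<Rightarrow> _)"
  by unfold_locales
    (simp_all add: algebra_simps const_def single_add flip: mult.assoc, simp add: mult_single)

interpretation free: vector_space "scale_free :: 'k::field \<Rightarrow> ('x, 'k) free_algebra \<Rightarrow> _"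
  by (rule vector_space_free)

lemma times_const_commute: "p * const c = const c * p"
proof -
  let ?term = "\<lambda>w. const (Poly_Mapping.lookup p w) * word (letters w)"
  have "p * const c = (\<Sum>w\<in>Poly_Mapping.keys p. ?term w * const c)"
    by (subst free_algebra_expansion[of p]) (rule sum_distrib_right)
  also have "\<dots> = (\<Sum>w\<in>Poly_Mapping.keys p. const c * ?term w)"
    by (simp add: const_def mult_single mult.commute)
  also have "\<dots> = const c * (\<Sum>w\<in>Poly_Mapping.keys p. ?term w)"
    by (rule sum_distrib_left[symmetric])
  also have "\<dots> = const c * p"
    by (subst (2) free_algebra_expansion[of p]) (rule refl)
  finally show ?thesis .
qed

lemma linear_left_mult: "Vector_Spaces.linear scale_free scale_free (\<lambda>p. a * p)"
  by (simp add: Vector_Spaces.linear_iff vector_space_free distrib_left times_const_commute flip: mult.assoc)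

lemma linear_right_mult: "Vector_Spaces.linear scale_free scale_free (\<lambda>p. p * a)"
  by (simp add: Vector_Spaces.linear_iff vector_space_free distrib_right mult.assoc)

lemma linear_eq_on_words:
  assumes "Vector_Spaces.linear scale_free s f" "Vector_Spaces.linear scale_free s g"
    and "\<And>w. f (word w) = g (word w)"
  shows "f p = g p"
proof -
  interpret f: Vector_Spaces.linear scale_free s f by fact
  interpret g: Vector_Spaces.linear scale_free s g by fact
  have w: "f (Poly_Mapping.single w 1) = g (Poly_Mapping.single w 1)" for w
    using assms(3)[of "letters w"] by simp
  show ?thesis
    by (subst (1 2) free_algebra_expansion[of p]) (simp add: f.sum g.sum f.scale g.scale w)
qed

definition extend_linearly ::
    "('x list \<Rightarrow> ('x, 'k::field) free_algebra) \<Rightarrow> ('x, 'k) free_algebra \<Rightarrow> ('x, 'k) free_algebra"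
  where "extend_linearly h p =
    (\<Sum>w\<in>Poly_Mapping.keys p. const (Poly_Mapping.lookup p w) * h (letters w))"

lemma extend_linearly_word: "extend_linearly h (word w) = h w"
  by (simp add: extend_linearly_def const_def)

lemma linear_extend_linearly: "Vector_Spaces.linear scale_free scale_free (extend_linearly h)"
proof -
  have "extend_linearly h (p + q) = extend_linearly h p + extend_linearly h q" for p q
    unfolding extend_linearly_def
    by (rule setsum_keys_plus_distrib) (simp_all add: const_def single_add distrib_right)
  moreover have "extend_linearly h (const c * p) = const c * extend_linearly h p" for c p
  proof (cases "c = 0")
    case False
    have "Poly_Mapping.keys (const c * p) = Poly_Mapping.keys p"
      using False by (auto simp: in_keys_iff lookup_const_times)
    then show ?thesis
      by (simp add: extend_linearly_def lookup_const_times sum_distrib_left const_times_const flip: mult.assoc)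
  qed (simp add: extend_linearly_def const_def)
  ultimately show ?thesis
    by (simp add: Vector_Spaces.linear_iff vector_space_free)
qed

section \<open>Generators acting by left multiplication and rewriting\<close>

text \<open>
  The first equation is the rewriting rule for \<open>u(23)u(3)\<close>. Each term on its right either begins
  with a letter that begins no left-hand side or is \<open>u(23)u(2)\<close>, so that for a normal
  word no further rewriting is possible. On words that are not normal the value is just
  what the same formula gives.
\<close>

fun u23_on_word :: "index list \<Rightarrow> (index, 'k::field) free_algebra"
  where
    "u23_on_word (I3 # w) = (u I3 * u I2 + u I23 * u I2 - u I2 * u I3) * word w"
  | "u23_on_word w = u I23 * word w"

definition act_u23 :: "(index, 'k::field) free_algebra \<Rightarrow> (index, 'k) free_algebra"
  where "act_u23 = extend_linearly u23_on_word"

text \<open>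
  The rule for \<open>u(12)u(3)\<close> moves \<open>u(12)\<close> to the right in three of its terms, where it acts
  recursively on the shorter word \<open>w\<close>; the letter that is then put in front, \<open>u(23)\<close> in one case, is
  again an operator. In the last four terms plain multiplication is enough, since no left-hand
  side contains \<open>u(13)\<close>.
\<close>

fun u12_on_word :: "index list \<Rightarrow> (index, 'k::field) free_algebra"
  where
    "u12_on_word (I3 # w) = u I3 * u12_on_word w + u I13 * u12_on_word w + act_u23 (u12_on_word w)
       - (u I2 * u I13 + u I12 * u I13 - u I13 * u I2 + u I23 * u I13) * word w"
  | "u12_on_word w = u I12 * word w"

definition act_u12 :: "(index, 'k::field) free_algebra \<Rightarrow> (index, 'k) free_algebra"
  where "act_u12 = extend_linearly u12_on_word"

fun u1_on_word :: "index list \<Rightarrow> (index, 'k::field) free_algebra"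
  where
    "u1_on_word (I2 # w) = u I2 * u1_on_word w + act_u12 (u1_on_word w) - u I12 * u I2 * word w"
  | "u1_on_word (I3 # w) = u I3 * u1_on_word w + u I13 * u1_on_word w - u I13 * u I3 * word w"
  | "u1_on_word (I23 # w) = act_u23 (u1_on_word w)
       + (u I2 * u I13 - u I13 * u I2 + u I12 * u I13 - u I12 * u I23
          + u I23 * u I13 - u I13 * u I23) * word w"
  | "u1_on_word w = u I1 * word w"

definition act_u1 :: "(index, 'k::field) free_algebra \<Rightarrow> (index, 'k) free_algebra"
  where "act_u1 = extend_linearly u1_on_word"

lemma linear_act_u23: "Vector_Spaces.linear scale_free scale_free act_u23"
  and linear_act_u12: "Vector_Spaces.linear scale_free scale_free act_u12"
  and linear_act_u1: "Vector_Spaces.linear scale_free scale_free act_u1"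
  by (simp_all add: act_u23_def act_u12_def act_u1_def linear_extend_linearly)

lemma act_word: "act_u23 (word w) = u23_on_word w" "act_u12 (word w) = u12_on_word w" "act_u1 (word w) = u1_on_word w"
  by (simp_all add: act_u23_def act_u12_def act_u1_def extend_linearly_word)

lemmas act_linear =
  linear_act_u23[THEN module_hom_linearI, THEN module_hom.add]
  linear_act_u23[THEN module_hom_linearI, THEN module_hom.diff]
  linear_act_u12[THEN module_hom_linearI, THEN module_hom.add]
  linear_act_u12[THEN module_hom_linearI, THEN module_hom.diff]
  linear_act_u1[THEN module_hom_linearI, THEN module_hom.add]
  linear_act_u1[THEN module_hom_linearI, THEN module_hom.diff]

lemma const_left_commute: "a * (const c * p) = const c * (a * p)"
  by (metis mult.assoc times_const_commute)

lemmas act_operator_linear =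
  Vector_Spaces.linear_iff vector_space_free const_left_commute act_linear
  linear_act_u23[THEN module_hom_linearI, THEN module_hom.scale]
  linear_act_u12[THEN module_hom_linearI, THEN module_hom.scale]
  linear_act_u1[THEN module_hom_linearI, THEN module_hom.scale]

text \<open>
  This and the next three lemmas are rewriting rules turned into identities of operators.
  They hold on every vector because the recursive definitions apply them to every word, normal
  or not. In terms such as \<open>u(23)u(2)\<close> the operator of \<open>u(23)\<close> may stand for multiplication by
  \<open>u(23)\<close>: the two agree on words that begin with \<open>u(2)\<close>.
\<close>

lemma act_u23_u3: "act_u23 (u I3 * p) = u I3 * (u I2 * p) + act_u23 (u I2 * p) - u I2 * (u I3 * p)"
  by (rule linear_eq_on_words[of scale_free _ _ p])
    (simp_all add: act_operator_linear gen_times_word act_word algebra_simps)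

lemma act_u12_u3:
  "act_u12 (u I3 * p) = u I3 * act_u12 p + u I13 * act_u12 p + act_u23 (act_u12 p)
     - u I2 * (u I13 * p) - act_u12 (u I13 * p) + u I13 * (u I2 * p) - act_u23 (u I13 * p)"
  by (rule linear_eq_on_words[of scale_free _ _ p])
    (simp_all add: act_operator_linear gen_times_word act_word algebra_simps)

lemma act_u1_u2: "act_u1 (u I2 * p) = u I2 * act_u1 p + act_u12 (act_u1 p) - act_u12 (u I2 * p)"
  by (rule linear_eq_on_words[of scale_free _ _ p])
    (simp_all add: act_operator_linear gen_times_word act_word algebra_simps)

lemma act_u1_u3: "act_u1 (u I3 * p) = u I3 * act_u1 p + u I13 * act_u1 p - u I13 * (u I3 * p)"
  by (rule linear_eq_on_words[of scale_free _ _ p])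
    (simp_all add: act_operator_linear gen_times_word act_word algebra_simps)

text \<open>
  On a word that does not begin with \<open>u(3)\<close> the operator of \<open>u(23)\<close> only prepends its letter, so
  the last rewriting rule is the definition of the operator of \<open>u(1)\<close>.
\<close>

lemma act_u1_act_u23_word:
  fixes w :: "index list"
  defines "p \<equiv> (word w :: (index, 'k::field) free_algebra)"
  assumes "\<nexists>v. w = I3 # v"
  shows "act_u1 (act_u23 p) = act_u23 (act_u1 p) - u I13 * act_u23 p - act_u12 (act_u23 p)
    + u I2 * (u I13 * p) + act_u12 (u I13 * p) - u I13 * (u I2 * p) + act_u23 (u I13 * p)"
proof -
  have "u23_on_word w = (word (I23 # w) :: (index, 'k) free_algebra)"
    using assms(2) by (cases w rule: u23_on_word.cases) (simp_all add: gen_times_word)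
  then show ?thesis
    by (simp add: p_def act_word gen_times_word algebra_simps)
qed

text \<open>
  The overlap \<open>u(1)u(23)u(3)\<close>. On a word \<open>u(3)v\<close> the left side first rewrites \<open>u(23)u(3)\<close> and the
  right side in effect first rewrites \<open>u(1)u(23)\<close>. Moving \<open>u(1)\<close> and \<open>u(12)\<close> to the right by the other four
  rules brings both to the same expression.
\<close>

lemma act_u1_act_u23:
  fixes p :: "(index, 'k::field) free_algebra"
  shows "act_u1 (act_u23 p) = act_u23 (act_u1 p) - u I13 * act_u23 p - act_u12 (act_u23 p)
    + u I2 * (u I13 * p) + act_u12 (u I13 * p) - u I13 * (u I2 * p) + act_u23 (u I13 * p)"
proof (rule linear_eq_on_words[of scale_free _ _ p])
  fix w :: "index list"
  let ?W = "word w :: (index, 'k) free_algebra"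
  show "act_u1 (act_u23 ?W) = act_u23 (act_u1 ?W) - u I13 * act_u23 ?W - act_u12 (act_u23 ?W)
    + u I2 * (u I13 * ?W) + act_u12 (u I13 * ?W) - u I13 * (u I2 * ?W) + act_u23 (u I13 * ?W)"
  proof (cases "\<exists>v. w = I3 # v")
    case True
    then obtain v where w: "?W = u I3 * word v"
      by (auto simp: gen_times_word)
    have "u I2 * word v = (word (I2 # v) :: (index, 'k) free_algebra)"
      by (rule gen_times_word)
    \<comment> \<open>Rewriting \<open>u(23)u(3)v\<close> leaves the term \<open>u(23)u(2)v\<close>, to which \<open>u(1)\<close> must be
      applied; this is the same relation on \<open>u(2)v\<close>, where it is already known.\<close>
    note shorter = act_u1_act_u23_word[where 'k='k and w = "I2 # v", folded this, simplified]
    show ?thesis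
      unfolding w
      by (simp add: act_linear act_u23_u3 act_u12_u3 act_u1_u2 act_u1_u3 shorter algebra_simps)
  qed (use act_u1_act_u23_word in blast)
qed (simp_all add: act_operator_linear algebra_simps)

section \<open>The normal form map and the ideal of relations\<close>

fun generator_action :: "index \<Rightarrow> (index, 'k::field) free_algebra \<Rightarrow> (index, 'k) free_algebra"
  where
    "generator_action I1 = act_u1"
  | "generator_action I12 = act_u12"
  | "generator_action I23 = act_u23"
  | "generator_action x = (*) (u x)"

definition normal_form :: "(index, 'k::field) free_algebra \<Rightarrow> (index, 'k) free_algebra"
  where "normal_form = extend_linearly (\<lambda>w. foldr generator_action w 1)"

lemma linear_normal_form: "Vector_Spaces.linear scale_free scale_free normal_form"
  by (simp add: normal_form_def linear_extend_linearly)

lemmas normal_form_linear =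
  linear_normal_form[THEN module_hom_linearI, THEN module_hom.add]
  linear_normal_form[THEN module_hom_linearI, THEN module_hom.diff]
  linear_normal_form[THEN module_hom_linearI, THEN module_hom.zero]

lemma linear_generator_action: "Vector_Spaces.linear scale_free scale_free (generator_action x)"
  by (cases x) (simp_all add: linear_act_u1 linear_act_u12 linear_act_u23 linear_left_mult)

lemma normal_form_word: "normal_form (word w) = foldr generator_action w 1"
  by (simp add: normal_form_def extend_linearly_word)

lemma normal_form_one: "normal_form 1 = 1"
  using normal_form_word[of "[]"] by (simp add: word_Nil)

lemma normal_form_gen_times: "normal_form (u x * p) = generator_action x (normal_form p)"
proof (rule linear_eq_on_words[of scale_free _ _ p])
  show "Vector_Spaces.linear scale_free scale_free (\<lambda>p. normal_form (u x * p))"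
    using Vector_Spaces.linear_compose[OF linear_left_mult linear_normal_form] by (simp add: comp_def)
  show "Vector_Spaces.linear scale_free scale_free (\<lambda>p. generator_action x (normal_form p))"
    using Vector_Spaces.linear_compose[OF linear_normal_form linear_generator_action] by (simp add: comp_def)
qed (simp add: gen_times_word normal_form_word)

text \<open>
  Multiplying by \<open>r\<close> from the left becomes applying to \<open>normal_form q\<close> the same polynomial in the
  operators, and the operators satisfy the relations on every vector.
\<close>

lemma normal_form_relator_times: "\<forall>r\<in>K3_relators. normal_form (r * q) = 0"
  by (simp add: K3_relators_def commutator_def normal_form_linear normal_form_gen_times
      act_u23_u3 act_u12_u3 act_u1_u2 act_u1_u3 act_u1_act_u23 algebra_simps)

lemma normal_form_times_eq_0:
  assumes "normal_form q = 0"
  shows "normal_form (p * q) = 0"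
proof (rule linear_eq_on_words[of scale_free _ _ p])
  show "Vector_Spaces.linear scale_free scale_free (\<lambda>p. normal_form (p * q))"
    using Vector_Spaces.linear_compose[OF linear_right_mult linear_normal_form] by (simp add: comp_def)
  show "Vector_Spaces.linear scale_free scale_free (\<lambda>p. 0)"
    by (simp add: Vector_Spaces.linear_iff vector_space_free)
  show "normal_form (word w * q) = 0" for w
  proof (induction w)
    case Nil
    then show ?case
      using assms by (simp add: word_Nil)
  next
    case (Cons x w)
    have "normal_form (word (x # w) * q) = generator_action x (normal_form (word w * q))"
      by (simp add: mult.assoc flip: gen_times_word normal_form_gen_times)
    also have "\<dots> = 0"
      by (simp add: Cons module_hom.zero[OF linear_generator_action[THEN module_hom_linearI]])
    finally show ?case .
  qed
qed

text \<open>
  The kernel of a linear map need not be an ideal; the elements \<open>p\<close> for which all \<open>a * p * b\<close>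
  lie in the kernel are one, and they include the relators.
\<close>

lemma normal_form_K3_ideal:
  assumes "p \<in> K3_ideal"
  shows "normal_form p = 0"
proof -
  have "K3_ideal \<subseteq> {p. \<forall>a b. normal_form (a * p * b) = 0}"
    unfolding K3_ideal_def
  proof (rule hull_minimal)
    show "K3_relators \<subseteq> {p. \<forall>a b. normal_form (a * p * b) = 0}"
      by (simp add: subset_iff mult.assoc normal_form_times_eq_0 normal_form_relator_times)
    show "two_sided_ideal {p. \<forall>a b. normal_form (a * p * b) = 0}"
      unfolding two_sided_ideal_def
      by (auto simp: normal_form_linear distrib_left distrib_right) (simp_all add: mult.assoc, metis mult.assoc)
  qed
  then have "normal_form (1 * p * 1) = 0"
    using assms by blast
  then show ?thesis
    by simp
qed

section \<open>Rewriting does not change the class in the quotient\<close>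

lemma linear_abs_K3: "Vector_Spaces.linear scale_free scale_K3 abs_K3"
  by (simp add: Vector_Spaces.linear_iff vector_space_free K3.vector_space_axioms
      plus_K3.abs_eq scale_K3.abs_eq)

lemmas abs_K3_simps = plus_K3.abs_eq[symmetric] minus_K3.abs_eq[symmetric] times_K3.abs_eq[symmetric]

lemma abs_K3_relator: "r \<in> K3_relators \<Longrightarrow> abs_K3 r = 0"
  unfolding zero_K3_def K3.abs_eq_iff K3_rel_def K3_ideal_def
  using hull_subset[of K3_relators two_sided_ideal] by auto

text \<open>
  The rewriting rules as equations in \<open>K\<^sub>3\<close>. The one for \<open>u(1)u(23)\<close> is the difference of the two
  long relations, in which the commutator of \<open>u(12)\<close> and \<open>u(3)\<close> cancels.
\<close>

lemma K3_relations:
  fixes U :: "index \<Rightarrow> 'k::field K3"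
  defines "U x \<equiv> abs_K3 (u x)"
  shows "U I23 * U I3 = U I3 * U I2 + U I23 * U I2 - U I2 * U I3"
    and "U I12 * U I3 = U I3 * U I12 + U I13 * U I12 + U I23 * U I12
       - U I2 * U I13 - U I12 * U I13 + U I13 * U I2 - U I23 * U I13"
    and "U I1 * U I2 = U I2 * U I1 + U I12 * U I1 - U I12 * U I2"
    and "U I1 * U I3 = U I3 * U I1 + U I13 * U I1 - U I13 * U I3"
    and "U I1 * U I23 = U I23 * U I1 + U I2 * U I13 - U I13 * U I2 + U I12 * U I13
       - U I12 * U I23 + U I23 * U I13 - U I13 * U I23"
proof -
  have "\<forall>r\<in>K3_relators. abs_K3 (r :: (index, 'k) free_algebra) = 0"
    using abs_K3_relator by blast
  then have rels:
    "U I1 * U I2 - U I2 * U I1 + U I12 * (U I2 - U I1) = 0"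
    "U I2 * U I3 - U I3 * U I2 + U I23 * (U I3 - U I2) = 0"
    "U I3 * U I1 - U I1 * U I3 + U I13 * (U I1 - U I3) = 0"
    "(U I12 * U I23 - U I23 * U I12) + (U I12 * U I3 - U I3 * U I12) + (U I1 * U I23 - U I23 * U I1)
      - U I13 * (U I12 - U I23) = 0"
    "(U I12 * U I13 - U I13 * U I12) + (U I12 * U I3 - U I3 * U I12) + (U I2 * U I13 - U I13 * U I2)
      - U I23 * (U I12 - U I13) = 0"
    by (simp_all add: K3_relators_def commutator_def U_def abs_K3_simps)
  have eqI: "x = y" if "z = 0" "x - y = z" for x y z :: "'k K3"
    using that by simp
  show "U I23 * U I3 = U I3 * U I2 + U I23 * U I2 - U I2 * U I3"
    by (rule eqI[OF rels(2)]) (simp add: algebra_simps)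
  show d: "U I12 * U I3 = U I3 * U I12 + U I13 * U I12 + U I23 * U I12
       - U I2 * U I13 - U I12 * U I13 + U I13 * U I2 - U I23 * U I13"
    by (rule eqI[OF rels(5)]) (simp add: algebra_simps)
  show "U I1 * U I2 = U I2 * U I1 + U I12 * U I1 - U I12 * U I2"
    by (rule eqI[OF rels(1)]) (simp add: algebra_simps)
  show "U I1 * U I3 = U I3 * U I1 + U I13 * U I1 - U I13 * U I3"
    by (rule sym, rule eqI[OF rels(3)]) (simp add: algebra_simps)
  show "U I1 * U I23 = U I23 * U I1 + U I2 * U I13 - U I13 * U I2 + U I12 * U I13
       - U I12 * U I23 + U I23 * U I13 - U I13 * U I23"
    by (rule eqI[OF rels(4)]) (simp add: d algebra_simps)
qed

lemma abs_K3_extend_linearly: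
  assumes "\<And>w. abs_K3 (h w) = abs_K3 a * abs_K3 (word w)"
  shows "abs_K3 (extend_linearly h p) = abs_K3 a * abs_K3 p"
proof (rule linear_eq_on_words[of scale_K3 _ _ p])
  show "Vector_Spaces.linear scale_free scale_K3 (\<lambda>p. abs_K3 (extend_linearly h p))"
    using Vector_Spaces.linear_compose[OF linear_extend_linearly linear_abs_K3] by (simp add: comp_def)
  show "Vector_Spaces.linear scale_free scale_K3 (\<lambda>p. abs_K3 a * abs_K3 p)"
    using Vector_Spaces.linear_compose[OF linear_left_mult linear_abs_K3]
    by (simp add: comp_def times_K3.abs_eq)
qed (simp add: assms extend_linearly_word)

lemma abs_K3_act_u23: "abs_K3 (act_u23 p) = abs_K3 (u I23) * abs_K3 p"
  unfolding act_u23_def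
proof (rule abs_K3_extend_linearly)
  show "abs_K3 (u23_on_word w) = abs_K3 (u I23) * abs_K3 (word w)" for w
    by (cases w rule: u23_on_word.cases)
      (simp_all add: abs_K3_simps K3_relations algebra_simps flip: gen_times_word,
       simp_all add: K3_relations algebra_simps flip: mult.assoc)
qed

lemma abs_K3_act_u12: "abs_K3 (act_u12 p) = abs_K3 (u I12) * abs_K3 p"
  unfolding act_u12_def
proof (rule abs_K3_extend_linearly)
  show "abs_K3 (u12_on_word w) = abs_K3 (u I12) * abs_K3 (word w)" for w
    by (induction w rule: u12_on_word.induct)
      (simp_all add: abs_K3_simps abs_K3_act_u23 flip: gen_times_word,
       simp_all add: K3_relations distrib_left distrib_right left_diff_distrib right_diff_distrib flip: mult.assoc)
qed

lemma abs_K3_act_u1: "abs_K3 (act_u1 p) = abs_K3 (u I1) * abs_K3 p"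
  unfolding act_u1_def
proof (rule abs_K3_extend_linearly)
  show "abs_K3 (u1_on_word w) = abs_K3 (u I1) * abs_K3 (word w)" for w
    by (induction w rule: u1_on_word.induct)
      (simp_all add: abs_K3_simps abs_K3_act_u23 abs_K3_act_u12 flip: gen_times_word,
       simp_all add: K3_relations distrib_left distrib_right left_diff_distrib right_diff_distrib flip: mult.assoc)
qed

text \<open>
  Each operator differs from multiplication by its generator only by rewriting, that is, by
  elements of the ideal.
\<close>

lemma abs_K3_normal_form: "abs_K3 (normal_form p) = abs_K3 p"
proof (rule linear_eq_on_words[of scale_K3 _ _ p])
  show "Vector_Spaces.linear scale_free scale_K3 (\<lambda>p. abs_K3 (normal_form p))"
    using Vector_Spaces.linear_compose[OF linear_normal_form linear_abs_K3] by (simp add: comp_def)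
  show "Vector_Spaces.linear scale_free scale_K3 abs_K3"
    by (rule linear_abs_K3)
  have step: "abs_K3 (generator_action x p) = abs_K3 (u x) * abs_K3 p" for x p
    by (cases x) (simp_all add: abs_K3_act_u23 abs_K3_act_u12 abs_K3_act_u1 times_K3.abs_eq)
  show "abs_K3 (normal_form (word w)) = abs_K3 (word w)" for w
    by (induction w)
      (simp_all add: word_Nil normal_form_one normal_form_gen_times step times_K3.abs_eq flip: gen_times_word)
qed

section \<open>Normal words form a basis\<close>

definition leading_pairs :: "(index \<times> index) set"
  where "leading_pairs = {(I1, I2), (I1, I3), (I1, I23), (I12, I3), (I23, I3)}"

definition normal_words :: "nat \<Rightarrow> index list set"
  where "normal_words n = {w. length w = n \<and> successively (\<lambda>x y. (x, y) \<notin> leading_pairs) w}"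

lemma normal_words_0: "normal_words 0 = {[]}"
  by (auto simp: normal_words_def)

lemma Cons_in_normal_words:
  "x # w \<in> normal_words (Suc n) \<longleftrightarrow>
    w \<in> normal_words n \<and> (w = [] \<or> (x, hd w) \<notin> leading_pairs)"
  by (auto simp: normal_words_def successively_Cons)

text \<open>
  The operators do more than prepend a letter exactly when this would create a leading pair, which
  does not happen while a normal word is built up from the right.
\<close>

lemma normal_word_fixed:
  assumes "w \<in> normal_words n"
  shows "normal_form (word w) = (word w :: (index, 'k::field) free_algebra)"
  using assms
proof (induction w arbitrary: n)
  case Nil
  show ?case
    by (simp add: word_Nil normal_form_one)
next
  case (Cons x w)
  obtain m where n: "n = Suc m"
    using Cons.prems by (cases n) (auto simp: normal_words_def)
  have "w \<in> normal_words m" and *: "w = [] \<or> (x, hd w) \<notin> leading_pairs"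
    using Cons.prems by (simp_all add: n Cons_in_normal_words)
  then have "normal_form (word (x # w)) = generator_action x (word w :: (index, 'k) free_algebra)"
    using Cons.IH by (simp add: normal_form_gen_times flip: gen_times_word)
  also have "\<dots> = u x * word w"
    using * by (cases x; cases w rule: u1_on_word.cases) (simp_all add: act_word leading_pairs_def)
  finally show ?case
    by (simp add: gen_times_word)
qed

definition normal_space :: "nat \<Rightarrow> (index, 'k::field) free_algebra set"
  where "normal_space n = free.span (word ` normal_words n)"

lemma normal_space_closed:
  "p \<in> normal_space n \<Longrightarrow> q \<in> normal_space n \<Longrightarrow> p + q \<in> normal_space n"
  "p \<in> normal_space n \<Longrightarrow> q \<in> normal_space n \<Longrightarrow> p - q \<in> normal_space n"
  "w \<in> normal_words n \<Longrightarrow> word w \<in> normal_space n"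
  by (simp_all add: normal_space_def free.span_add free.span_diff free.span_base)

lemma linear_image_normal_space:
  assumes "Vector_Spaces.linear scale_free scale_free f"
    and "\<And>w. w \<in> normal_words n \<Longrightarrow> f (word w) \<in> normal_space m"
    and "p \<in> normal_space n"
  shows "f p \<in> normal_space m"
proof -
  interpret f: Vector_Spaces.linear scale_free scale_free f by fact
  show ?thesis
    using assms(3) unfolding normal_space_def
  proof (induction rule: free.span_induct_alt)
    case base
    show ?case
      by (simp add: free.span_zero)
  next
    case (step c x y)
    then show ?case
      using assms(2) by (auto simp: f.add f.scale normal_space_def intro!: free.span_add free.span_scale)
  qed
qed

text \<open>
  Here and for the three operators below, the point is that prepending leads from normal words
  of length \<open>n\<close> to combinations of normal words of length \<open>n + 1\<close>. The letters \<open>u(2)\<close>,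
  \<open>u(3)\<close> and \<open>u(13)\<close> can stand in front of any normal word.
\<close>

lemma free_letter_normal_space:
  assumes "p \<in> normal_space n" "x \<in> {I2, I3, I13}"
  shows "u x * p \<in> normal_space (Suc n)"
  by (rule linear_image_normal_space[OF linear_left_mult _ assms(1)])
    (use assms(2) in \<open>auto simp: gen_times_word Cons_in_normal_words leading_pairs_def intro!: normal_space_closed\<close>)

lemma act_u23_normal_space:
  assumes "p \<in> normal_space n"
  shows "act_u23 p \<in> normal_space (Suc n)"
proof (rule linear_image_normal_space[OF linear_act_u23 _ assms])
  show "act_u23 (word w) \<in> normal_space (Suc n)" if "w \<in> normal_words n" for w
    using that
    by (cases w rule: u23_on_word.cases; cases n)
      (auto simp: act_word algebra_simps gen_times_word Cons_in_normal_words leading_pairs_def normal_words_0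
        intro!: normal_space_closed)
qed

lemma u12_on_word_normal_space:
  "w \<in> normal_words n \<Longrightarrow> u12_on_word w \<in> normal_space (Suc n)"
proof (induction w arbitrary: n rule: u12_on_word.induct)
  case (1 w)
  then obtain m where n: "n = Suc m" and w: "w \<in> normal_words m"
    by (cases n) (auto simp: Cons_in_normal_words normal_words_0)
  show ?case
    using w "1.IH"[OF w] unfolding n u12_on_word.simps
    by (simp only: distrib_right left_diff_distrib mult.assoc gen_times_word)
      (intro normal_space_closed act_u23_normal_space free_letter_normal_space;
        simp add: Cons_in_normal_words leading_pairs_def)
qed (auto simp: gen_times_word Cons_in_normal_words leading_pairs_def intro!: normal_space_closed)

lemma act_u12_normal_space:
  assumes "p \<in> normal_space n"
  shows "act_u12 p \<in> normal_space (Suc n)"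
  by (rule linear_image_normal_space[OF linear_act_u12 _ assms]) (simp add: act_word u12_on_word_normal_space)

lemma u1_on_word_normal_space:
  "w \<in> normal_words n \<Longrightarrow> u1_on_word w \<in> normal_space (Suc n)"
proof (induction w arbitrary: n rule: u1_on_word.induct)
  case (1 w)
  then obtain m where n: "n = Suc m" and w: "w \<in> normal_words m"
    by (cases n) (auto simp: Cons_in_normal_words normal_words_0)
  show ?case
    using w "1.IH"[OF w] unfolding n u1_on_word.simps
    by (simp only: distrib_right left_diff_distrib mult.assoc gen_times_word)
      (intro normal_space_closed act_u12_normal_space free_letter_normal_space;
        simp add: Cons_in_normal_words leading_pairs_def)
next
  case (2 w)
  then obtain m where n: "n = Suc m" and w: "w \<in> normal_words m"
    by (cases n) (auto simp: Cons_in_normal_words normal_words_0)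
  show ?case
    using w "2.IH"[OF w] unfolding n u1_on_word.simps
    by (simp only: distrib_right left_diff_distrib mult.assoc gen_times_word)
      (intro normal_space_closed act_u12_normal_space free_letter_normal_space;
        simp add: Cons_in_normal_words leading_pairs_def)
next
  case (3 w)
  then obtain m where n: "n = Suc m" and w: "w \<in> normal_words m" "w = [] \<or> hd w \<noteq> I3"
    by (cases n) (auto simp: Cons_in_normal_words normal_words_0 leading_pairs_def)
  show ?case
    using w "3.IH"[OF w(1)] unfolding n u1_on_word.simps
    by (simp only: distrib_right left_diff_distrib mult.assoc gen_times_word)
      (intro normal_space_closed act_u23_normal_space free_letter_normal_space;
        simp add: Cons_in_normal_words leading_pairs_def)
qed (auto simp: gen_times_word Cons_in_normal_words leading_pairs_def intro!: normal_space_closed)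

lemma act_u1_normal_space:
  assumes "p \<in> normal_space n"
  shows "act_u1 p \<in> normal_space (Suc n)"
  by (rule linear_image_normal_space[OF linear_act_u1 _ assms]) (simp add: act_word u1_on_word_normal_space)

lemma normal_form_word_in_normal_space:
  "normal_form (word w) \<in> (normal_space (length w) :: (index, 'k::field) free_algebra set)"
proof (induction w)
  case Nil
  show ?case
    using normal_space_closed(3)[of "[]" 0] by (simp add: normal_words_0 word_Nil normal_form_one)
next
  case (Cons x w)
  have "normal_form (word (x # w)) = generator_action x (normal_form (word w :: (index, 'k) free_algebra))"
    by (simp add: normal_form_gen_times flip: gen_times_word)
  then show ?case
    using Cons
    by (cases x) (simp_all add: act_u1_normal_space act_u12_normal_space act_u23_normal_space free_letter_normal_space)
qed

lemma normal_form_homogeneous: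
  assumes "p \<in> homogeneous n"
  shows "normal_form p \<in> normal_space n"
proof -
  interpret nf: Vector_Spaces.linear scale_free scale_free normal_form
    by (rule linear_normal_form)
  have "normal_form (\<Sum>w\<in>Poly_Mapping.keys p. const (Poly_Mapping.lookup p w) * word (letters w))
      \<in> normal_space n"
    unfolding nf.sum nf.scale normal_space_def
  proof (intro free.span_sum free.span_scale)
    fix w assume "w \<in> Poly_Mapping.keys p"
    then have "length (letters w) = n"
      using assms by (auto simp: homogeneous_def)
    then show "normal_form (word (letters w)) \<in> free.span (word ` normal_words n)"
      using normal_form_word_in_normal_space[of "letters w"] by (simp add: normal_space_def)
  qed
  then show ?thesis
    by (simp only: free_algebra_expansion[of p, symmetric])
qed

lemma UNIV_index: "UNIV = {I1, I2, I3, I12, I13, I23}"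
proof (rule UNIV_eq_I)
  show "x \<in> {I1, I2, I3, I12, I13, I23}" for x
    by (cases x) simp_all
qed

lemma finite_normal_words: "finite (normal_words n)"
proof (rule finite_subset)
  show "normal_words n \<subseteq> {w. set w \<subseteq> UNIV \<and> length w = n}"
    by (auto simp: normal_words_def)
  show "finite {w :: index list. set w \<subseteq> UNIV \<and> length w = n}"
    by (rule finite_lists_length_eq) (simp add: UNIV_index)
qed

text \<open>
  Normal words that are dependent in \<open>K\<^sub>3\<close> have a combination in the ideal. The normal form map kills
  it but also fixes it, so it is zero already in the free algebra.
\<close>

lemma normal_words_independent:
  assumes "(\<Sum>w\<in>normal_words n. scale_K3 (c w) (abs_K3 (word w))) = 0" "v \<in> normal_words n"
  shows "c v = (0 :: 'k::field)"
proof -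
  interpret abs: Vector_Spaces.linear scale_free scale_K3 "abs_K3 :: (index, 'k) free_algebra \<Rightarrow> _"
    by (rule linear_abs_K3)
  interpret nf: Vector_Spaces.linear scale_free scale_free "normal_form :: (index, 'k) free_algebra \<Rightarrow> _"
    by (rule linear_normal_form)
  define p where "p = (\<Sum>w\<in>normal_words n. const (c w) * word w :: (index, 'k) free_algebra)"
  have "abs_K3 p = 0"
    using assms(1) by (simp add: p_def abs.sum abs.scale)
  then have "p \<in> K3_ideal"
    unfolding zero_K3_def K3.abs_eq_iff K3_rel_def by simp
  then have "normal_form p = 0"
    by (rule normal_form_K3_ideal)
  moreover have "normal_form p = p"
    by (simp add: p_def nf.sum nf.scale normal_word_fixed)
  ultimately have "Poly_Mapping.lookup p (Word v) = 0"
    by simp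
  then show ?thesis
    using assms(2) finite_normal_words
    by (simp add: p_def lookup_sum const_times_single lookup_single when_def)
qed

lemma dim_K3_component: "K3.dim (K3_component n :: 'k::field K3 set) = card (normal_words n)"
proof -
  let ?b = "\<lambda>w. abs_K3 (word w) :: 'k K3"
  interpret abs: Vector_Spaces.linear scale_free scale_K3 "abs_K3 :: (index, 'k) free_algebra \<Rightarrow> _"
    by (rule linear_abs_K3)
  have inj: "inj_on ?b (normal_words n)"
  proof (rule inj_onI)
    fix v w assume vw: "v \<in> normal_words n" "w \<in> normal_words n" "?b v = ?b w"
    have "normal_form (word v - word w :: (index, 'k) free_algebra) = 0"
      using vw(3) by (intro normal_form_K3_ideal) (simp add: K3.abs_eq_iff K3_rel_def)
    then have "(word v :: (index, 'k) free_algebra) = word w"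
      using vw(1,2) by (simp add: normal_form_linear normal_word_fixed)
    then show "v = w"
      by (metis free_monoid.inject lookup_single_eq lookup_single_not_eq zero_neq_one)
  qed
  have "card (?b ` normal_words n) = K3.dim (K3_component n :: 'k K3 set)"
  proof (rule K3.basis_card_eq_dim)
    show "?b ` normal_words n \<subseteq> K3_component n"
      by (auto simp: K3_component_def homogeneous_def normal_words_def intro!: imageI)
    show "K3_component n \<subseteq> K3.span (?b ` normal_words n)"
    proof
      fix x :: "'k K3" assume "x \<in> K3_component n"
      then obtain p :: "(index, 'k) free_algebra" where p: "p \<in> homogeneous n" "x = abs_K3 p"
        by (auto simp: K3_component_def)
      have "x = abs_K3 (normal_form p)"
        by (simp add: p abs_K3_normal_form)
      also have "\<dots> \<in> abs_K3 ` free.span (word ` normal_words n)"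
        using normal_form_homogeneous[OF p(1)] by (simp add: normal_space_def)
      also have "\<dots> = K3.span (?b ` normal_words n)"
        by (simp add: image_image flip: abs.span_image)
      finally show "x \<in> K3.span (?b ` normal_words n)" .
    qed
    show "K3.independent (?b ` normal_words n)"
    proof (rule K3.independent_if_scalars_zero)
      fix f :: "'k K3 \<Rightarrow> 'k" and x
      assume *: "(\<Sum>x\<in>?b ` normal_words n. scale_K3 (f x) x) = 0" "x \<in> ?b ` normal_words n"
      then show "f x = 0"
        using normal_words_independent[of "\<lambda>w. f (?b w)" n] by (auto simp: sum.reindex[OF inj])
    qed (simp add: finite_normal_words)
  qed
  then show ?thesis
    by (simp add: card_image[OF inj])
qed

section \<open>Counting normal words\<close>

definition normal_words_from :: "index \<Rightarrow> nat \<Rightarrow> index list set"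
  where "normal_words_from x n = {w \<in> normal_words n. w \<noteq> [] \<and> hd w = x}"

text \<open>
  A normal word beginning with \<open>x\<close> is \<open>x\<close> followed by a normal word that does not begin with a
  letter forbidden after \<open>x\<close>. The excluded words are added on the left in order to avoid
  subtraction of natural numbers.
\<close>

lemma card_normal_words_from:
  "card (normal_words_from x (Suc n)) + (\<Sum>y | (x, y) \<in> leading_pairs. card (normal_words_from y n))
    = card (normal_words n)"
proof -
  let ?ok = "{w \<in> normal_words n. w = [] \<or> (x, hd w) \<notin> leading_pairs}"
  let ?bad = "\<Union>y\<in>{y. (x, y) \<in> leading_pairs}. normal_words_from y n"
  have fin: "finite {y. (x, y) \<in> leading_pairs}"
    by (rule finite_subset[OF subset_UNIV]) (simp add: UNIV_index)
  have "normal_words_from x (Suc n) = (#) x ` ?ok"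
  proof (rule set_eqI)
    show "v \<in> normal_words_from x (Suc n) \<longleftrightarrow> v \<in> (#) x ` ?ok" for v
      by (cases v) (auto simp: normal_words_from_def Cons_in_normal_words)
  qed
  then have "card (normal_words_from x (Suc n)) = card ?ok"
    by (simp add: card_image)
  moreover have "card ?bad = (\<Sum>y | (x, y) \<in> leading_pairs. card (normal_words_from y n))"
    by (rule card_UN_disjoint) (auto simp: normal_words_from_def finite_normal_words fin)
  moreover have "card (?ok \<union> ?bad) = card ?ok + card ?bad"
  proof (rule card_Un_disjoint)
    show "finite ?ok" "finite ?bad"
      by (simp_all add: finite_normal_words normal_words_from_def fin)
  qed (auto simp: normal_words_from_def)
  moreover have "?ok \<union> ?bad = normal_words n"
    by (auto simp: normal_words_from_def)
  ultimately show ?thesis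
    by simp
qed

lemma card_normal_words_Suc:
  "card (normal_words (Suc n)) = (\<Sum>x\<in>UNIV. card (normal_words_from x (Suc n)))"
proof -
  have "normal_words (Suc n) = (\<Union>x\<in>UNIV. normal_words_from x (Suc n))"
    by (auto simp: normal_words_from_def normal_words_def)
  also have "card \<dots> = (\<Sum>x\<in>UNIV. card (normal_words_from x (Suc n)))"
    by (rule card_UN_disjoint) (auto simp: normal_words_from_def finite_normal_words UNIV_index)
  finally show ?thesis .
qed

lemma leading_pairs_successors:
  "{y. (I1, y) \<in> leading_pairs} = {I2, I3, I23}"
  "{y. (I12, y) \<in> leading_pairs} = {I3}"
  "{y. (I23, y) \<in> leading_pairs} = {I3}"
  "{y. (I2, y) \<in> leading_pairs} = {}"
  "{y. (I3, y) \<in> leading_pairs} = {}"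
  "{y. (I13, y) \<in> leading_pairs} = {}"
  by (auto simp: leading_pairs_def)

lemma normal_words_from_0: "normal_words_from x 0 = {}"
  by (auto simp: normal_words_from_def normal_words_def)

lemmas card_normal_words_from_letter =
  card_normal_words_from[of I1, unfolded leading_pairs_successors, simplified]
  card_normal_words_from[of I2, unfolded leading_pairs_successors, simplified]
  card_normal_words_from[of I3, unfolded leading_pairs_successors, simplified]
  card_normal_words_from[of I12, unfolded leading_pairs_successors, simplified]
  card_normal_words_from[of I13, unfolded leading_pairs_successors, simplified]
  card_normal_words_from[of I23, unfolded leading_pairs_successors, simplified]

lemma card_normal_words_initial:
  "card (normal_words 0) = 1" "card (normal_words (Suc 0)) = 6" "card (normal_words (Suc (Suc 0))) = 31"
proof -
  show 0: "card (normal_words 0) = 1"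
    by (simp add: normal_words_0)
  show 1: "card (normal_words (Suc 0)) = 6"
    using 0 card_normal_words_from_letter[of 0]
    by (simp add: card_normal_words_Suc UNIV_index normal_words_from_0)
  show "card (normal_words (Suc (Suc 0))) = 31"
    using 0 1 card_normal_words_from_letter[of 0] card_normal_words_from_letter[of "Suc 0"]
    by (simp add: card_normal_words_Suc[of "Suc 0"] UNIV_index normal_words_from_0)
qed

text \<open>
  Let \<open>t n\<close> be the number of normal words of length \<open>n\<close>. Of the \<open>6 t (n + 2)\<close> ways to put a
  letter in front of a normal word, five types of leading pair are excluded, each accounting for
  \<open>t (n + 1)\<close> words at first count. For the pair \<open>u(1)u(23)\<close> that count is too large by the
  \<open>t n\<close> words in which \<open>u(3)\<close> follows \<open>u(23)\<close>; this is the contribution of the overlap.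
\<close>

lemma card_normal_words_recurrence:
  "card (normal_words (Suc (Suc (Suc n)))) + 5 * card (normal_words (Suc n))
    = 6 * card (normal_words (Suc (Suc n))) + card (normal_words n)"
  using card_normal_words_from_letter[of "Suc (Suc n)"] card_normal_words_from_letter[of "Suc n"]
    card_normal_words_from_letter[of n] card_normal_words_Suc[of "Suc (Suc n)"]
  by (simp add: UNIV_index)

theorem theorem5:
  shows "K3_hilbert_series TYPE('k::field) = 1 / (1 - 6 * fps_X + 5 * fps_X ^ 2 - fps_X ^ 3)"
proof -
  define t :: "nat \<Rightarrow> rat" where "t = (\<lambda>n. of_nat (card (normal_words n)))"
  define D :: "rat fps" where "D = 1 - 6 * fps_X + 5 * fps_X ^ 2 - fps_X ^ 3"
  have t_initial: "t 0 = 1" "t (Suc 0) = 6" "t (Suc (Suc 0)) = 31"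
    by (simp_all add: t_def card_normal_words_initial)
  have t_rec: "t (Suc (Suc (Suc n))) = 6 * t (Suc (Suc n)) - 5 * t (Suc n) + t n" for n
    using arg_cong[OF card_normal_words_recurrence[of n], of "of_nat :: nat \<Rightarrow> rat"]
    by (simp add: t_def)
  \<comment> \<open>The recurrence makes the coefficients of this product vanish from degree \<open>3\<close> on; the
      initial values \<open>1, 6, 31\<close> give \<open>1, 0, 0\<close> in the lower degrees.\<close>
  have "D * Abs_fps t = Abs_fps t - fps_const 6 * (fps_X * Abs_fps t)
      + fps_const 5 * (fps_X ^ 2 * Abs_fps t) - fps_X ^ 3 * Abs_fps t"
    by (simp add: D_def algebra_simps flip: numeral_fps_const)
  also have "\<dots> = 1"
  proof (rule fps_ext)
    fix n
    consider "n = 0" | "n = Suc 0" | "n = Suc (Suc 0)" | m where "n = Suc (Suc (Suc m))"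
      by (metis not0_implies_Suc)
    then show "fps_nth (Abs_fps t - fps_const 6 * (fps_X * Abs_fps t)
      + fps_const 5 * (fps_X ^ 2 * Abs_fps t) - fps_X ^ 3 * Abs_fps t) n = fps_nth 1 n"
      by cases (simp_all add: fps_X_power_mult_nth t_initial t_rec)
  qed
  finally have "D * Abs_fps t = 1" .
  moreover have "D \<noteq> 0"
    using calculation by auto
  ultimately have "Abs_fps t = 1 / D"
    by (metis nonzero_mult_div_cancel_left)
  then show ?thesis
    by (simp add: K3_hilbert_series_def dim_K3_component t_def D_def)
qed

end
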